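(* Let $m\ge 1$ and $n\ge 1$ be integers and let $\mathbf r=(r_1,\dots,r_n)$ be an $n$-tuple of positive real numbers. The moduli space $M_{\mathbf r}$ of closed polygons with side-lengths $\mathbf r$ is nonempty if and only if $$m\,r_i\le r_1+r_2+\cdots+\widehat{r_i}+\cdots+r_n\qquad (1\le i\le n),$$ where $\widehat{r_i}$ means that $r_i$ is omitted from the sum.
   Context: $\mathcal H_{m+1}$ is the real vector space of $(m+1)\times(m+1)$ Hermitian matrices, $\mathbb I$ the identity. $(\cdot,\cdot)$ is the standard Hermitian inner product on $\mathbb C^{m+1}$, linear in the first argument; for a unit vector $w$, $w\otimes w^*$ denotes the rank-one projection $v\mapsto (v,w)w$. For $r>0$ let $\mathcal O_r=\{r\,w\otimes w^*:\|w\|=1\}\subset\mathcal H_{m+1}$. Put $\Lambda=\frac1{m+1}\sum_{i=1}^n r_i$, $\widetilde M_{\mathbf r}=\{\mathbf e=(e_1,\dots,e_n)\in\prod_{i=1}^n\mathcal O_{r_i}:\sum_i e_i=\Lambda\mathbb I\}$ (closed polygons with side-lengths $\mathbf r$), and $M_{\mathbf r}=\widetilde M_{\mathbf r}/U(m+1)$, the quotient by simultaneous conjugation. *)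

theory Defs
  imports "Jordan_Normal_Form.Schur_Decomposition"
begin

definition hermitian_space :: "nat \<Rightarrow> complex mat set" where
  "hermitian_space d = {A \<in> carrier_mat d d. mat_adjoint A = A}"

definition unitary_group :: "nat \<Rightarrow> complex mat set" where
  "unitary_group d = {U \<in> carrier_mat d d. mat_adjoint U * U = 1\<^sub>m d}"

text \<open>\<open>v \<bullet>c w\<close> is conjugate-linear in the second argument.\<close>

definition cvec_norm :: "complex vec \<Rightarrow> real" where
  "cvec_norm w = sqrt (Re (w \<bullet>c w))"

text \<open>The matrix of \<open>v \<mapsto> (v, w) w\<close>; see \<open>rank_one_mult_vec\<close> below.\<close>

definition rank_one :: "complex vec \<Rightarrow> complex mat" where
  "rank_one w = mat (dim_vec w) (dim_vec w) (\<lambda>(j, k). w $ j * cnj (w $ k))"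

definition orbit :: "nat \<Rightarrow> real \<Rightarrow> complex mat set" where
  "orbit d \<rho> = {complex_of_real \<rho> \<cdot>\<^sub>m rank_one w | w. w \<in> carrier_vec d \<and> cvec_norm w = 1}"

definition Lam :: "nat \<Rightarrow> nat \<Rightarrow> (nat \<Rightarrow> real) \<Rightarrow> real" where
  "Lam m n r = 1 / real (m + 1) * (\<Sum>i = 1..n. r i)"

text \<open>Matrices of unspecified dimension form no monoid type, so the sum is the
  \<open>finsum\<close> of the ring of \<open>(m + 1) \<times> (m + 1)\<close> matrices.\<close>

definition closed_polygons :: "nat \<Rightarrow> nat \<Rightarrow> (nat \<Rightarrow> real) \<Rightarrow> (nat \<Rightarrow> complex mat) set" where
  "closed_polygons m n r =
    {e \<in> (\<Pi>\<^sub>E i\<in>{1..n}. orbit (m + 1) (r i)).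
      finsum (ring_mat TYPE(complex) (m + 1) ()) e {1..n}
        = complex_of_real (Lam m n r) \<cdot>\<^sub>m 1\<^sub>m (m + 1)}"

definition conj_rel :: "nat \<Rightarrow> nat \<Rightarrow> (nat \<Rightarrow> real) \<Rightarrow> (nat \<Rightarrow> complex mat) rel" where
  "conj_rel m n r =
    {(e, e'). e \<in> closed_polygons m n r \<and> e' \<in> closed_polygons m n r \<and>
      (\<exists>U\<in>unitary_group (m + 1). \<forall>i\<in>{1..n}. e' i = U * e i * mat_adjoint U)}"

definition moduli_space :: "nat \<Rightarrow> nat \<Rightarrow> (nat \<Rightarrow> real) \<Rightarrow> (nat \<Rightarrow> complex mat) set set" where
  "moduli_space m n r = closed_polygons m n r // conj_rel m n r"


lemma mat_adjoint_eq_mat: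
  "mat_adjoint (A :: complex mat) = mat (dim_col A) (dim_row A) (\<lambda>(i, j). cnj (A $$ (j, i)))"
  by (rule eq_matI) (auto simp: mat_adjoint_def mat_of_rows_def conjugate_complex_def)

lemma mat_adjoint_carrier [simp]:
  "(A :: complex mat) \<in> carrier_mat a b \<Longrightarrow> mat_adjoint A \<in> carrier_mat b a"
  by (auto simp: mat_adjoint_eq_mat)

lemma mat_adjoint_mat_adjoint [simp]: "mat_adjoint (mat_adjoint A) = (A :: complex mat)"
  by (rule eq_matI) (auto simp: mat_adjoint_eq_mat)

lemma mat_adjoint_one [simp]: "mat_adjoint (1\<^sub>m d) = (1\<^sub>m d :: complex mat)"
  by (rule eq_matI) (auto simp: mat_adjoint_eq_mat)

lemma mat_adjoint_mult:
  fixes A B :: "complex mat"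
  assumes "A \<in> carrier_mat a b" "B \<in> carrier_mat b c"
  shows "mat_adjoint (A * B) = mat_adjoint B * mat_adjoint A"
  using assms
  by (intro eq_matI) (auto simp: mat_adjoint_eq_mat scalar_prod_def mult.commute)

lemma rank_one_mult_vec:
  assumes "w \<in> carrier_vec d" "v \<in> carrier_vec d"
  shows "rank_one w *\<^sub>v v = (v \<bullet>c w) \<cdot>\<^sub>v w"
  using assms
  by (intro eq_vecI)
    (auto simp: rank_one_def scalar_prod_def sum_distrib_left sum_distrib_right ac_simps
      intro!: sum.cong)

lemma cvec_norm_eq_1_iff: "cvec_norm w = 1 \<longleftrightarrow> w \<bullet>c w = 1"
proof -
  have "w \<bullet>c w \<ge> 0" by (rule conjugate_square_ge_0_vec)
  then have "Im (w \<bullet>c w) = 0" by (simp add: less_eq_complex_def)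
  then show ?thesis by (simp add: cvec_norm_def complex_eq_iff)
qed

lemma orbit_subset_hermitian_space: "orbit d \<rho> \<subseteq> hermitian_space d"
proof
  fix A assume "A \<in> orbit d \<rho>"
  then obtain w where "w \<in> carrier_vec d" "A = complex_of_real \<rho> \<cdot>\<^sub>m rank_one w"
    by (auto simp: orbit_def)
  then show "A \<in> hermitian_space d"
    by (auto simp: hermitian_space_def rank_one_def mat_adjoint_eq_mat intro!: eq_matI)
qed

lemma index_finsum_mat:
  fixes f :: "'a \<Rightarrow> complex mat"
  assumes "finite I" "\<And>i. i \<in> I \<Longrightarrow> f i \<in> carrier_mat d d" "j < d" "k < d"
  shows "finsum (ring_mat TYPE(complex) d b) f I $$ (j, k) = (\<Sum>i\<in>I. f i $$ (j, k))"
proof -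
  interpret R: ring "ring_mat TYPE(complex) d b" by (rule ring_mat)
  have "finsum (ring_mat TYPE(complex) d b) f I \<in> carrier_mat d d \<and>
    finsum (ring_mat TYPE(complex) d b) f I $$ (j, k) = (\<Sum>i\<in>I. f i $$ (j, k))"
    using assms(1,2)
  proof (induction I rule: finite_induct)
    case empty
    then show ?case using assms(3,4) by (simp add: ring_mat_simps)
  next
    case (insert x F)
    have "finsum (ring_mat TYPE(complex) d b) f (insert x F)
      = f x + finsum (ring_mat TYPE(complex) d b) f F"
      using insert by (subst R.finsum_insert) (auto simp: ring_mat_simps)
    with insert assms(3,4) show ?case by auto
  qed
  then show ?thesis ..
qed

lemma equiv_conj_rel: "equiv (closed_polygons m n r) (conj_rel m n r)"
proof -
  let ?d = "m + 1"
  have car: "e i \<in> carrier_mat ?d ?d" if "e \<in> closed_polygons m n r" "i \<in> {1..n}" for e i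
  proof -
    have "e i \<in> orbit ?d (r i)" using that by (auto simp: closed_polygons_def PiE_def)
    then show ?thesis using orbit_subset_hermitian_space by (auto simp: hermitian_space_def)
  qed
  show ?thesis
  proof (rule equivI)
    show "conj_rel m n r \<subseteq> closed_polygons m n r \<times> closed_polygons m n r"
      by (auto simp: conj_rel_def)
    show "refl_on (closed_polygons m n r) (conj_rel m n r)"
    proof (rule refl_onI)
      fix e assume e: "e \<in> closed_polygons m n r"
      have "1\<^sub>m ?d \<in> unitary_group ?d" by (simp add: unitary_group_def)
      moreover have "\<forall>i\<in>{1..n}. e i = 1\<^sub>m ?d * e i * mat_adjoint (1\<^sub>m ?d)"
        by (metis car[OF e] left_mult_one_mat right_mult_one_mat mat_adjoint_one)
      ultimately show "(e, e) \<in> conj_rel m n r" using e unfolding conj_rel_def by blast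
    qed
    show "sym (conj_rel m n r)"
    proof (rule symI)
      fix e e' assume "(e, e') \<in> conj_rel m n r"
      then obtain U where e: "e \<in> closed_polygons m n r" "e' \<in> closed_polygons m n r"
        and U: "U \<in> carrier_mat ?d ?d" "mat_adjoint U * U = 1\<^sub>m ?d"
        and c: "\<forall>i\<in>{1..n}. e' i = U * e i * mat_adjoint U"
        by (auto simp: conj_rel_def unitary_group_def)
      have U': "mat_adjoint U \<in> carrier_mat ?d ?d" using U(1) by (rule mat_adjoint_carrier)
      have "U * mat_adjoint U = 1\<^sub>m ?d"
        using mat_mult_left_right_inverse[OF U' U(1) U(2)] .
      then have "mat_adjoint U \<in> unitary_group ?d" using U' by (simp add: unitary_group_def)
      moreover have "e i = mat_adjoint U * e' i * mat_adjoint (mat_adjoint U)"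
        if i: "i \<in> {1..n}" for i
      proof -
        have E: "e i \<in> carrier_mat ?d ?d" using car[OF e(1) i] .
        have "mat_adjoint U * e' i * U = mat_adjoint U * (U * (e i * (mat_adjoint U * U)))"
          using c i E U(1) U' by (simp add: assoc_mult_mat[of _ ?d ?d _ ?d _ ?d])
        also have "\<dots> = (mat_adjoint U * U) * e i"
          using E U U' by (simp add: assoc_mult_mat[of _ ?d ?d _ ?d _ ?d, symmetric])
        also have "\<dots> = e i" using E U(2) by simp
        finally show ?thesis by simp
      qed
      ultimately show "(e', e) \<in> conj_rel m n r" using e unfolding conj_rel_def by blast
    qed
    show "trans (conj_rel m n r)"
    proof (rule transI)
      fix e1 e2 e3 assume "(e1, e2) \<in> conj_rel m n r" "(e2, e3) \<in> conj_rel m n r"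
      then obtain U V where e: "e1 \<in> closed_polygons m n r" "e3 \<in> closed_polygons m n r"
        and U: "U \<in> carrier_mat ?d ?d" "mat_adjoint U * U = 1\<^sub>m ?d"
        and V: "V \<in> carrier_mat ?d ?d" "mat_adjoint V * V = 1\<^sub>m ?d"
        and c: "\<forall>i\<in>{1..n}. e2 i = U * e1 i * mat_adjoint U"
          "\<forall>i\<in>{1..n}. e3 i = V * e2 i * mat_adjoint V"
        by (auto simp: conj_rel_def unitary_group_def)
      note cs = U(1) V(1) mat_adjoint_carrier[OF U(1)] mat_adjoint_carrier[OF V(1)]
      note adj = mat_adjoint_mult[OF V(1) U(1)]
      have "mat_adjoint U * mat_adjoint V * (V * U) = mat_adjoint U * ((mat_adjoint V * V) * U)"
        using cs by (simp add: assoc_mult_mat[of _ ?d ?d _ ?d _ ?d])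
      then have "V * U \<in> unitary_group ?d"
        using cs U(2) V(2) by (simp add: unitary_group_def adj)
      moreover have "e3 i = V * U * e1 i * mat_adjoint (V * U)" if i: "i \<in> {1..n}" for i
        using c i cs mult_carrier_mat[OF cs(3,4)] car[OF e(1) i]
        by (simp add: adj assoc_mult_mat[of _ ?d ?d _ ?d _ ?d])
      ultimately show "(e1, e3) \<in> conj_rel m n r" using e unfolding conj_rel_def by blast
    qed
  qed
qed

end

theory Submission
  imports Defs
begin

text \<open>
  Pairing the closing condition \<open>\<Sum>\<^sub>i r\<^sub>i w\<^sub>i \<otimes> w\<^sub>i\<^sup>* = \<Lambda> I\<close> with \<open>w\<^sub>p\<close> gives
  \<open>\<Sum>\<^sub>i r\<^sub>i |(w\<^sub>p, w\<^sub>i)|\<^sup>2 = \<Lambda>\<close>, whose \<open>p\<close>-th term is \<open>r\<^sub>p\<close>; hence \<open>r\<^sub>p \<le> \<Lambda>\<close>, which is the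
  stated inequality. Conversely, start from the \<open>n\<close> vectors consisting of \<open>\<surd>\<Lambda>\<close> times the standard
  basis and \<open>n - m - 1\<close> zero vectors. Rotating a pair \<open>(v\<^sub>i, v\<^sub>j)\<close> to
  \<open>(c v\<^sub>i + s v\<^sub>j, c v\<^sub>j - s v\<^sub>i)\<close> does not change \<open>\<Sum>\<^sub>i v\<^sub>i \<otimes> v\<^sub>i\<^sup>*\<close>, and by the intermediate value
  theorem the new \<open>|v\<^sub>i|\<^sup>2\<close> can be any number between the old \<open>|v\<^sub>i|\<^sup>2\<close> and \<open>|v\<^sub>j|\<^sup>2\<close>. Such rotations
  adjust the squared norms to \<open>r\<^sub>i\<close> one at a time. Real vectors suffice.
\<close>

section \<open>Real frames with prescribed squared norms\<close>

lemma rotation_prescribed_norm: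
  fixes f g :: "'k \<Rightarrow> real"
  assumes "(\<Sum>k\<in>J. (f k)\<^sup>2) \<le> t \<and> t \<le> (\<Sum>k\<in>J. (g k)\<^sup>2) \<or>
    (\<Sum>k\<in>J. (g k)\<^sup>2) \<le> t \<and> t \<le> (\<Sum>k\<in>J. (f k)\<^sup>2)"
  obtains c s where "c\<^sup>2 + s\<^sup>2 = 1" "(\<Sum>k\<in>J. (c * f k + s * g k)\<^sup>2) = t"
proof -
  \<comment> \<open>A quarter turn suffices: the angle 0 gives \<open>f\<close> and
    \<open>pi/2\<close> gives \<open>g\<close>.\<close>
  define \<phi> where "\<phi> \<theta> = (\<Sum>k\<in>J. (cos \<theta> * f k + sin \<theta> * g k)\<^sup>2)" for \<theta> :: real
  have cont: "continuous_on {0..pi/2} \<phi>"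
    unfolding \<phi>_def by (intro continuous_intros)
  have ends: "\<phi> 0 = (\<Sum>k\<in>J. (f k)\<^sup>2)" "\<phi> (pi/2) = (\<Sum>k\<in>J. (g k)\<^sup>2)"
    by (simp_all add: \<phi>_def)
  have "\<exists>\<theta>. \<phi> \<theta> = t"
    using assms
  proof
    assume "(\<Sum>k\<in>J. (f k)\<^sup>2) \<le> t \<and> t \<le> (\<Sum>k\<in>J. (g k)\<^sup>2)"
    then show ?thesis using IVT'[of \<phi> 0 t "pi/2"] cont ends by auto
  next
    assume "(\<Sum>k\<in>J. (g k)\<^sup>2) \<le> t \<and> t \<le> (\<Sum>k\<in>J. (f k)\<^sup>2)"
    then show ?thesis using IVT2'[of \<phi> "pi/2" t 0] cont ends by auto
  qed
  then obtain \<theta> where "\<phi> \<theta> = t" ..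
  then show thesis using that[of "cos \<theta>" "sin \<theta>"] by (simp add: \<phi>_def)
qed

text \<open>
  At each step the only squared norm outside \<open>{0, L}\<close> is the one at \<open>p\<close>; it is rotated to its
  final value against an index \<open>j\<close> of the appropriate extreme norm, and \<open>j\<close> takes over its role.
\<close>

lemma frame_adjust_norms:
  fixes v :: "'i \<Rightarrow> 'k \<Rightarrow> real" and r :: "'i \<Rightarrow> real"
  assumes "finite N" "p \<in> N"
    and "\<And>i. i \<in> N \<Longrightarrow> 0 \<le> r i \<and> r i \<le> L"
    and "(\<Sum>k\<in>J. (v p k)\<^sup>2) \<le> L"
    and "\<And>i. i \<in> N - {p} \<Longrightarrow> (\<Sum>k\<in>J. (v i k)\<^sup>2) \<in> {0, L}"
    and "(\<Sum>i\<in>N. \<Sum>k\<in>J. (v i k)\<^sup>2) = (\<Sum>i\<in>N. r i)"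
  shows "\<exists>u :: 'i \<Rightarrow> 'k \<Rightarrow> real. (\<forall>i\<in>N. (\<Sum>k\<in>J. (u i k)\<^sup>2) = r i) \<and>
    (\<forall>k l. (\<Sum>i\<in>N. u i k * u i l) = (\<Sum>i\<in>N. v i k * v i l))"
  using assms
proof (induction "card N" arbitrary: N p v)
  case 0
  then show ?case by simp
next
  case (Suc q)
  let ?S = "\<lambda>x. \<Sum>k\<in>J. (x k)\<^sup>2"
  define M where "M = N - {p}"
  have N: "N = insert p M" "p \<notin> M" "finite M" and cM: "q = card M"
    using Suc.prems(1,2) Suc.hyps(2) by (auto simp: M_def)
  have sum_eq: "?S (v p) + (\<Sum>i\<in>M. ?S (v i)) = r p + (\<Sum>i\<in>M. r i)"
    using Suc.prems(6) N by simp
  have rM: "0 \<le> r i" "r i \<le> L" if "i \<in> M" for i using Suc.prems(3) that N by auto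
  have vM: "?S (v i) \<in> {0, L}" if "i \<in> M" for i using Suc.prems(5) that N by auto
  have rp: "0 \<le> r p" "r p \<le> L" using Suc.prems(2,3) by auto
  show ?case
  proof (cases "M = {}")
    case True
    then show ?thesis using sum_eq N by (intro exI[of _ v]) simp
  next
    case False
    \<comment> \<open>Both totals agree. If \<open>v p\<close> is too long, the others cannot all
      have squared norm \<open>L\<close>, so one is zero; if it is too short, they cannot all be
      zero, so one has squared norm \<open>L\<close>. If it already fits, any \<open>j\<close>
      works, as \<open>r p\<close> lies between 0 and \<open>L\<close>.\<close>
    have "\<exists>j\<in>M. ?S (v p) \<le> r p \<and> r p \<le> ?S (v j) \<or> ?S (v j) \<le> r p \<and> r p \<le> ?S (v p)"
    proof (cases "r p" "?S (v p)" rule: linorder_cases)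
      case equal
      with False rp show ?thesis using vM by fastforce
    next
      case less
      have "\<exists>j\<in>M. ?S (v j) = 0"
      proof (rule ccontr)
        assume "\<not> ?thesis"
        with vM rM have "(\<Sum>i\<in>M. r i) \<le> (\<Sum>i\<in>M. ?S (v i))" by (intro sum_mono) auto
        with less sum_eq show False by simp
      qed
      then obtain j where "j \<in> M" "?S (v j) = 0" ..
      with less rp show ?thesis by (intro bexI[of _ j]) auto
    next
      case greater
      have "\<exists>j\<in>M. ?S (v j) = L"
      proof (rule ccontr)
        assume "\<not> ?thesis"
        with vM have "(\<Sum>i\<in>M. ?S (v i)) = 0" by (intro sum.neutral) auto
        moreover have "(\<Sum>i\<in>M. r i) \<ge> 0" using rM by (intro sum_nonneg) auto
        ultimately show False using greater sum_eq by simp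
      qed
      then obtain j where "j \<in> M" "?S (v j) = L" ..
      with greater rp show ?thesis by (intro bexI[of _ j]) auto
    qed
    then obtain j where j: "j \<in> M"
      and btw: "?S (v p) \<le> r p \<and> r p \<le> ?S (v j) \<or> ?S (v j) \<le> r p \<and> r p \<le> ?S (v p)"
      by blast
    obtain c s where cs: "c\<^sup>2 + s\<^sup>2 = 1" and norm_p: "?S (\<lambda>k. c * v p k + s * v j k) = r p"
      using rotation_prescribed_norm[OF btw] by blast
    define x where "x k = c * v p k + s * v j k" for k
    have Sx: "?S x = r p" using norm_p by (simp add: x_def)
    \<comment> \<open>The second half of the rotation of the pair at \<open>p\<close> and
      \<open>j\<close>.\<close>
    define y where "y k = c * v j k - s * v p k" for k
    have rot: "x k * x l + y k * y l = v p k * v p l + v j k * v j l" for k l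
    proof -
      have "x k * x l + y k * y l = (c\<^sup>2 + s\<^sup>2) * (v p k * v p l + v j k * v j l)"
        by (simp add: x_def y_def algebra_simps power2_eq_square)
      then show ?thesis by (simp add: cs)
    qed
    have "?S x + ?S y = ?S (v p) + ?S (v j)"
      unfolding sum.distrib[symmetric] using rot by (simp add: power2_eq_square)
    then have Sy: "?S y = ?S (v p) + ?S (v j) - r p" using Sx by simp
    define v' where "v' = v(j := y)"
    have v': "v' j = y" "\<And>i. i \<noteq> j \<Longrightarrow> v' i = v i" by (simp_all add: v'_def)
    \<comment> \<open>\<open>h\<close> stays general because it is used both for the squared norm
      and for the products \<open>f k * f l\<close>.\<close>
    have split: "(\<Sum>i\<in>M. h (w i)) = h (w j) + (\<Sum>i\<in>M - {j}. h (w i))"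
      for h :: "('k \<Rightarrow> real) \<Rightarrow> real" and w :: "'i \<Rightarrow> 'k \<Rightarrow> real"
      using j N(3) by (simp add: sum.remove)
    have rest: "(\<Sum>i\<in>M - {j}. h (v' i)) = (\<Sum>i\<in>M - {j}. h (v i))"
      for h :: "('k \<Rightarrow> real) \<Rightarrow> real"
      by (rule sum.cong) (auto simp: v'(2))
    have "\<exists>u :: 'i \<Rightarrow> 'k \<Rightarrow> real. (\<forall>i\<in>M. ?S (u i) = r i) \<and>
      (\<forall>k l. (\<Sum>i\<in>M. u i k * u i l) = (\<Sum>i\<in>M. v' i k * v' i l))"
    proof (rule Suc.hyps(1)[OF cM N(3) j])
      show "0 \<le> r i \<and> r i \<le> L" if "i \<in> M" for i using rM that by blast
      \<comment> \<open>As \<open>r p\<close> lies between the two old squared norms, so does the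
        new one at \<open>j\<close>, since their sum is preserved.\<close>
      show "?S (v' j) \<le> L" using Sy btw v'(1) vM[OF j] Suc.prems(4) rp by auto
      show "?S (v' i) \<in> {0, L}" if "i \<in> M - {j}" for i using vM that v'(2) by auto
      show "(\<Sum>i\<in>M. ?S (v' i)) = (\<Sum>i\<in>M. r i)"
        using split[of ?S v] split[of ?S v'] rest[of ?S] v'(1) Sy sum_eq by simp
    qed
    then obtain u :: "'i \<Rightarrow> 'k \<Rightarrow> real" where u: "\<And>i. i \<in> M \<Longrightarrow> ?S (u i) = r i"
      and u_frame: "\<And>k l. (\<Sum>i\<in>M. u i k * u i l) = (\<Sum>i\<in>M. v' i k * v' i l)"
      by blast
    define z where "z = u(p := x)"
    have z: "z p = x" "\<And>i. i \<in> M \<Longrightarrow> z i = u i" using N(2) by (auto simp: z_def)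
    have "?S (z i) = r i" if "i \<in> N" for i
      using that N(1) z u Sx by auto
    moreover have "(\<Sum>i\<in>N. z i k * z i l) = (\<Sum>i\<in>N. v i k * v i l)" for k l
    proof -
      have "(\<Sum>i\<in>N. z i k * z i l) = x k * x l + (\<Sum>i\<in>M. u i k * u i l)"
        using N z by simp
      also have "\<dots> = x k * x l + y k * y l + (\<Sum>i\<in>M - {j}. v i k * v i l)"
        using u_frame[of k l] split[of "\<lambda>f. f k * f l" v'] rest[of "\<lambda>f. f k * f l"] v'(1)
        by simp
      also have "\<dots> = (\<Sum>i\<in>N. v i k * v i l)"
        using rot[of k l] split[of "\<lambda>f. f k * f l" v] N by simp
      finally show ?thesis .
    qed
    ultimately show ?thesis by blast
  qed
qed

lemma tight_frame_exists:
  fixes r :: "nat \<Rightarrow> real"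
  assumes "d \<ge> 1" "L > 0" "\<And>i. i \<in> {1..n} \<Longrightarrow> 0 \<le> r i \<and> r i \<le> L"
    and "(\<Sum>i=1..n. r i) = real d * L"
  obtains u :: "nat \<Rightarrow> nat \<Rightarrow> real" where "\<And>i. i \<in> {1..n} \<Longrightarrow> (\<Sum>k<d. (u i k)\<^sup>2) = r i"
    and "\<And>k l. k < d \<Longrightarrow> l < d \<Longrightarrow> (\<Sum>i=1..n. u i k * u i l) = (if k = l then L else 0)"
proof -
  \<comment> \<open>There must be room for \<open>d\<close> scaled basis vectors among
    \<open>n\<close> indices.\<close>
  have "real d * L \<le> real n * L"
    using sum_mono[of "{1..n}" r "\<lambda>_. L"] assms(3,4) by simp
  then have dn: "d \<le> n" using assms(2) by simp
  \<comment> \<open>Indices start at 1 but coordinates at 0, hence \<open>Suc k\<close>; indices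
    beyond \<open>d\<close> carry the zero vector.\<close>
  define v :: "nat \<Rightarrow> nat \<Rightarrow> real" where "v i k = (if i = Suc k then sqrt L else 0)" for i k
  have S: "(\<Sum>k<d. (v i k)\<^sup>2) = (if i \<le> d then L else 0)" if "i \<in> {1..n}" for i
  proof -
    have "(\<Sum>k<d. (v i k)\<^sup>2) = (\<Sum>k<d. if k = i - 1 then L else 0)"
      using that assms(2) by (intro sum.cong) (auto simp: v_def)
    then show ?thesis using that by auto
  qed
  have F: "(\<Sum>i=1..n. v i k * v i l) = (if k = l then L else 0)" if "k < d" "l < d" for k l
  proof -
    have "(\<Sum>i=1..n. v i k * v i l) = (\<Sum>i=1..n. if i = Suc k then (if k = l then L else 0) else 0)"
      using assms(2) by (intro sum.cong) (auto simp: v_def)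
    then show ?thesis using that dn by auto
  qed
  have "\<exists>u :: nat \<Rightarrow> nat \<Rightarrow> real. (\<forall>i\<in>{1..n}. (\<Sum>k<d. (u i k)\<^sup>2) = r i) \<and>
    (\<forall>k l. (\<Sum>i=1..n. u i k * u i l) = (\<Sum>i=1..n. v i k * v i l))"
  \<comment> \<open>All squared norms are still 0 or \<open>L\<close>, so any index may act as the
    exceptional one.\<close>
  proof (rule frame_adjust_norms[where p = 1])
    show "1 \<in> {1..n}" using dn assms(1) by simp
    then show "(\<Sum>k<d. (v 1 k)\<^sup>2) \<le> L"
      using S[of 1] assms(2) by auto
    show "(\<Sum>k<d. (v i k)\<^sup>2) \<in> {0, L}" if "i \<in> {1..n} - {1}" for i
      using S[of i] that by auto
    \<comment> \<open>The total of the squared norms is the trace of the frame matrix,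
      \<open>d * L\<close>.\<close>
    have "(\<Sum>i=1..n. \<Sum>k<d. (v i k)\<^sup>2) = (\<Sum>k<d. \<Sum>i=1..n. v i k * v i k)"
      by (subst sum.swap) (simp add: power2_eq_square)
    also have "\<dots> = (\<Sum>i=1..n. r i)" using F assms(4) by simp
    finally show "(\<Sum>i=1..n. \<Sum>k<d. (v i k)\<^sup>2) = (\<Sum>i=1..n. r i)" .
  qed (use assms(3) in auto)
  then show thesis using that F by metis
qed

section \<open>Closed polygons in coordinates\<close>

lemma cscalar_self: "w \<in> carrier_vec d \<Longrightarrow> w \<bullet>c w = (\<Sum>k<d. w $ k * cnj (w $ k))"
  by (auto simp: scalar_prod_def atLeast0LessThan)

lemma smult_rank_one_index:
  assumes "w \<in> carrier_vec d" "k < d" "l < d"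
  shows "(c \<cdot>\<^sub>m rank_one w) $$ (k, l) = c * (w $ k * cnj (w $ l))"
  using assms by (auto simp: rank_one_def)

text \<open>Together with \<open>closed_polygonsE\<close>, this trades the sum in the matrix ring
  for entrywise sums of complex numbers, so both directions can be argued without matrix
  algebra.\<close>

lemma closed_polygonsI:
  fixes w :: "nat \<Rightarrow> complex vec"
  assumes w: "\<And>i. i \<in> {1..n} \<Longrightarrow> w i \<in> carrier_vec (m + 1) \<and> cvec_norm (w i) = 1"
    and frame: "\<And>k l. k < m + 1 \<Longrightarrow> l < m + 1 \<Longrightarrow>
      (\<Sum>i=1..n. complex_of_real (r i) * (w i $ k * cnj (w i $ l)))
        = (if k = l then complex_of_real (Lam m n r) else 0)"
  shows "(\<lambda>i\<in>{1..n}. complex_of_real (r i) \<cdot>\<^sub>m rank_one (w i)) \<in> closed_polygons m n r"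
proof -
  let ?d = "m + 1"
  let ?e = "\<lambda>i\<in>{1..n}. complex_of_real (r i) \<cdot>\<^sub>m rank_one (w i)"
  let ?R = "ring_mat TYPE(complex) ?d ()"
  interpret R: ring ?R by (rule ring_mat)
  have car: "?e i \<in> carrier_mat ?d ?d" if "i \<in> {1..n}" for i
    using w[OF that] that by (auto simp: rank_one_def)
  \<comment> \<open>The dimensions of the sum must be known before entries can be compared.\<close>
  have "finsum ?R ?e {1..n} \<in> carrier ?R"
    using car by (intro R.finsum_closed) (auto simp: ring_mat_simps)
  then have "finsum ?R ?e {1..n} \<in> carrier_mat ?d ?d" by (simp add: ring_mat_simps)
  moreover have "finsum ?R ?e {1..n} $$ (k, l) = (if k = l then complex_of_real (Lam m n r) else 0)"
    if "k < ?d" "l < ?d" for k l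
  proof -
    have "finsum ?R ?e {1..n} $$ (k, l) = (\<Sum>i=1..n. ?e i $$ (k, l))"
      using car that by (intro index_finsum_mat) auto
    also have "\<dots> = (\<Sum>i=1..n. complex_of_real (r i) * (w i $ k * cnj (w i $ l)))"
      using w that by (intro sum.cong refl) (simp add: smult_rank_one_index[of _ ?d])
    finally show ?thesis using frame that by simp
  qed
  ultimately have "finsum ?R ?e {1..n} = complex_of_real (Lam m n r) \<cdot>\<^sub>m 1\<^sub>m ?d"
    by (intro eq_matI) auto
  moreover have "?e \<in> (\<Pi>\<^sub>E i\<in>{1..n}. orbit ?d (r i))"
    using w by (auto simp: orbit_def)
  ultimately show ?thesis by (simp add: closed_polygons_def)
qed

lemma closed_polygonsE:
  assumes "e \<in> closed_polygons m n r"
  obtains w :: "nat \<Rightarrow> complex vec"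
  where "\<And>i. i \<in> {1..n} \<Longrightarrow> w i \<in> carrier_vec (m + 1) \<and> cvec_norm (w i) = 1"
    and "\<And>k l. k < m + 1 \<Longrightarrow> l < m + 1 \<Longrightarrow>
      (\<Sum>i=1..n. complex_of_real (r i) * (w i $ k * cnj (w i $ l)))
        = (if k = l then complex_of_real (Lam m n r) else 0)"
proof -
  let ?d = "m + 1"
  have "\<forall>i\<in>{1..n}. \<exists>w. e i = complex_of_real (r i) \<cdot>\<^sub>m rank_one w \<and>
    w \<in> carrier_vec ?d \<and> cvec_norm w = 1"
    using assms by (fastforce simp: closed_polygons_def PiE_def Pi_def orbit_def)
  then obtain w where w: "\<And>i. i \<in> {1..n} \<Longrightarrow> e i = complex_of_real (r i) \<cdot>\<^sub>m rank_one (w i) \<and>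
    w i \<in> carrier_vec ?d \<and> cvec_norm (w i) = 1"
    by metis
  show thesis
  proof (rule that)
    show "w i \<in> carrier_vec ?d \<and> cvec_norm (w i) = 1" if "i \<in> {1..n}" for i
      using w[OF that] by blast
    fix k l assume kl: "k < ?d" "l < ?d"
    have car: "e i \<in> carrier_mat ?d ?d" if "i \<in> {1..n}" for i
      using w[OF that] by (auto simp: rank_one_def)
    have "(\<Sum>i=1..n. complex_of_real (r i) * (w i $ k * cnj (w i $ l))) = (\<Sum>i=1..n. e i $$ (k, l))"
      using w kl by (intro sum.cong refl) (simp add: smult_rank_one_index[of _ ?d])
    also have "\<dots> = finsum (ring_mat TYPE(complex) ?d ()) e {1..n} $$ (k, l)"
      using car kl by (intro index_finsum_mat[symmetric]) auto
    also have "\<dots> = (if k = l then complex_of_real (Lam m n r) else 0)"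
      using assms kl by (simp add: closed_polygons_def)
    finally show "(\<Sum>i=1..n. complex_of_real (r i) * (w i $ k * cnj (w i $ l)))
      = (if k = l then complex_of_real (Lam m n r) else 0)" .
  qed
qed

section \<open>Necessity and sufficiency of the side-length bound\<close>

lemma closed_polygon_side_le:
  assumes "e \<in> closed_polygons m n r" "p \<in> {1..n}" "\<And>i. i \<in> {1..n} \<Longrightarrow> r i \<ge> 0"
  shows "r p \<le> Lam m n r"
proof -
  let ?d = "m + 1"
  obtain w where w: "\<And>i. i \<in> {1..n} \<Longrightarrow> w i \<in> carrier_vec ?d \<and> cvec_norm (w i) = 1"
    and frame: "\<And>k l. k < ?d \<Longrightarrow> l < ?d \<Longrightarrow>
      (\<Sum>i=1..n. complex_of_real (r i) * (w i $ k * cnj (w i $ l)))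
        = (if k = l then complex_of_real (Lam m n r) else 0)"
    using closed_polygonsE[OF assms(1)] by blast
  \<comment> \<open>\<open>g i\<close> is the inner product of \<open>w i\<close> with
    \<open>w p\<close>.\<close>
  define g where "g i = (\<Sum>k<?d. w i $ k * cnj (w p $ k))" for i
  have gp: "g p = 1"
    using w[OF assms(2)] cscalar_self[of "w p" ?d] by (simp add: g_def cvec_norm_eq_1_iff)
  have "complex_of_real (\<Sum>i=1..n. r i * (cmod (g i))\<^sup>2)
      = (\<Sum>i=1..n. complex_of_real (r i) * (g i * cnj (g i)))"
    by (simp only: of_real_sum of_real_mult complex_norm_square)
  \<comment> \<open>This is the quadratic form of the matrix sum at \<open>w p\<close>; once the sum
    over \<open>i\<close> is innermost, \<open>frame\<close> evaluates it.\<close>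
  also have "\<dots> = (\<Sum>i=1..n. \<Sum>k<?d. \<Sum>l<?d.
      cnj (w p $ k) * w p $ l * (complex_of_real (r i) * (w i $ k * cnj (w i $ l))))"
    unfolding g_def cnj_sum sum_product unfolding sum_distrib_left
    by (intro sum.cong refl) (simp add: ac_simps)
  also have "\<dots> = (\<Sum>k<?d. \<Sum>l<?d. \<Sum>i=1..n.
      cnj (w p $ k) * w p $ l * (complex_of_real (r i) * (w i $ k * cnj (w i $ l))))"
    by (subst sum.swap, rule sum.cong[OF refl], rule sum.swap)
  also have "\<dots> = (\<Sum>k<?d. \<Sum>l<?d.
      if l = k then cnj (w p $ k) * w p $ k * complex_of_real (Lam m n r) else 0)"
    unfolding sum_distrib_left[symmetric] by (intro sum.cong refl) (subst frame, auto)
  also have "\<dots> = complex_of_real (Lam m n r) * g p"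
    by (simp add: g_def sum_distrib_left ac_simps del: sum.lessThan_Suc)
  finally have eq: "(\<Sum>i=1..n. r i * (cmod (g i))\<^sup>2) = Lam m n r"
    using gp by (simp only: mult_1_right of_real_eq_iff)
  have "r p * (cmod (g p))\<^sup>2 \<le> (\<Sum>i=1..n. r i * (cmod (g i))\<^sup>2)"
    using assms(2,3) by (intro member_le_sum) auto
  then show ?thesis using eq gp by simp
qed

lemma closed_polygon_exists:
  assumes "n \<ge> 1" "\<And>i. i \<in> {1..n} \<Longrightarrow> r i > 0 \<and> r i \<le> Lam m n r"
  shows "closed_polygons m n r \<noteq> {}"
proof -
  let ?d = "m + 1"
  have L: "Lam m n r > 0" using assms(2)[of 1] assms(1) by simp
  have sum: "(\<Sum>i=1..n. r i) = real ?d * Lam m n r" by (simp add: Lam_def)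
  obtain u :: "nat \<Rightarrow> nat \<Rightarrow> real" where u: "\<And>i. i \<in> {1..n} \<Longrightarrow> (\<Sum>k<?d. (u i k)\<^sup>2) = r i"
    and frame: "\<And>k l. k < ?d \<Longrightarrow> l < ?d \<Longrightarrow>
      (\<Sum>i=1..n. u i k * u i l) = (if k = l then Lam m n r else 0)"
    using tight_frame_exists[of ?d "Lam m n r" n r] L sum assms(2) by (auto simp: less_imp_le)
  \<comment> \<open>Normalised frame vectors: the factor \<open>r i\<close> of the orbit cancels the
    two square roots.\<close>
  define w where "w i = vec ?d (\<lambda>k. complex_of_real (u i k / sqrt (r i)))" for i
  have "w i \<in> carrier_vec ?d \<and> cvec_norm (w i) = 1" if i: "i \<in> {1..n}" for i
  proof
    show car: "w i \<in> carrier_vec ?d" by (simp add: w_def)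
    have "w i \<bullet>c w i = (\<Sum>k<?d. complex_of_real ((u i k)\<^sup>2 / r i))"
      unfolding cscalar_self[OF car] using assms(2)[OF i]
      by (intro sum.cong refl)
        (simp add: w_def power2_eq_square flip: of_real_mult of_real_divide)
    also have "\<dots> = complex_of_real ((\<Sum>k<?d. (u i k)\<^sup>2) / r i)"
      by (simp only: of_real_sum sum_divide_distrib)
    also have "\<dots> = 1" using u[OF i] assms(2)[OF i] by simp
    finally show "cvec_norm (w i) = 1" by (simp add: cvec_norm_eq_1_iff)
  qed
  moreover have "(\<Sum>i=1..n. complex_of_real (r i) * (w i $ k * cnj (w i $ l)))
      = (if k = l then complex_of_real (Lam m n r) else 0)" if "k < ?d" "l < ?d" for k l
  proof -
    have "complex_of_real (r i) * (w i $ k * cnj (w i $ l)) = complex_of_real (u i k * u i l)"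
      if i: "i \<in> {1..n}" for i
      using assms(2)[OF i] \<open>k < ?d\<close> \<open>l < ?d\<close>
      by (simp add: w_def flip: of_real_mult of_real_divide)
    then have "(\<Sum>i=1..n. complex_of_real (r i) * (w i $ k * cnj (w i $ l)))
        = complex_of_real (\<Sum>i=1..n. u i k * u i l)"
      by simp
    then show ?thesis unfolding frame[OF that] by simp
  qed
  ultimately show ?thesis using closed_polygonsI[of n w m r] by blast
qed

theorem theorem3p1p1:
  fixes m n :: nat and r :: "nat \<Rightarrow> real"
  assumes "m \<ge> 1" and "n \<ge> 1"
    and "\<And>i. i \<in> {1..n} \<Longrightarrow> r i > 0"
  shows "moduli_space m n r \<noteq> {} \<longleftrightarrow>
    (\<forall>i\<in>{1..n}. real m * r i \<le> (\<Sum>j\<in>{1..n} - {i}. r j))"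
proof -
  \<comment> \<open>Adding \<open>r i\<close> to both sides gives \<open>(m + 1) * r i\<close>
    against the full sum.\<close>
  have le_iff: "real m * r i \<le> (\<Sum>j\<in>{1..n} - {i}. r j) \<longleftrightarrow> r i \<le> Lam m n r" if "i \<in> {1..n}" for i
  proof -
    have "(\<Sum>j=1..n. r j) = r i + (\<Sum>j\<in>{1..n} - {i}. r j)"
      using that by (simp add: sum.remove)
    then show ?thesis by (simp add: Lam_def field_simps)
  qed
  \<comment> \<open>A quotient has a class for every element, so it is empty only if the underlying
    set is.\<close>
  have "moduli_space m n r \<noteq> {} \<longleftrightarrow> closed_polygons m n r \<noteq> {}"
    by (auto simp: moduli_space_def quotient_def)
  also have "\<dots> \<longleftrightarrow> (\<forall>i\<in>{1..n}. r i \<le> Lam m n r)"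
    using closed_polygon_side_le[of _ m n r] closed_polygon_exists[of n r m] assms(2,3)
    by (auto simp: less_imp_le)
  finally show ?thesis using le_iff by simp
qed

end
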